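(* Let $\lambda>0$ and $f=h+\overline{g}\in\Omega_{\mathcal{H}}^0(\lambda)$. Then $f$ is stable harmonic univalent, and is also stable harmonic starlike, in $\{z\in\mathbb{D}:|z|<\tfrac{1}{2\lambda}\}$. In particular, $f$ is univalent, and also starlike, in $\{z\in\mathbb{D}:|z|<\tfrac{1}{2\lambda}\}$.
   Context: $\mathbb{D}=\{z\in\mathbb{C}:|z|<1\}$. $\mathcal{H}^0$ is the class of complex-valued harmonic functions $f=h+\overline{g}$ on $\mathbb{D}$, where $h,g$ are analytic on $\mathbb{D}$ with $h(z)=z+\sum_{n\ge2}a_nz^n$ and $g(z)=\sum_{n\ge2}b_nz^n$. For $\lambda>0$, $\Omega_{\mathcal{H}}^0(\lambda)$ is the set of $f=h+\overline{g}\in\mathcal{H}^0$ such that $|h(z)-zh'(z)|<\lambda-|g(z)-zg'(z)|$ for all $z\in\mathbb{D}$. A function is univalent in a disk if it is injective there; a harmonic function is starlike in a disk centered at $0$ if it maps that disk onto a domain that is starlike with respect to the origin (it contains the segment joining $0$ to each of its points). $f=h+\overline{g}$ is stable harmonic univalent (respectively, starlike) in a disk if for every $\zeta\in\mathbb{C}$ with $|\zeta|=1$ the harmonic function $f_\zeta=h+\zeta\overline{g}$ is univalent (respectively, starlike) in that disk. *)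

theory Defs
  imports "HOL-Complex_Analysis.Complex_Analysis"
begin

abbreviation unit_disk :: "complex set" (\<open>\<bbbD>\<close>) where
  "\<bbbD> \<equiv> ball 0 1"

text \<open>
  Functions on the disk are total functions whose values outside \<open>\<bbbD>\<close> are irrelevant.
  The decomposition \<open>f = h + cnj g\<close> of a harmonic function is determined on \<open>\<bbbD>\<close> only up to
  an additive constant; the normalisation \<open>g 0 = 0\<close> makes \<open>h\<close> and \<open>g\<close> unique on \<open>\<bbbD>\<close>. Hence
  the existential quantifiers over \<open>h\<close> and \<open>g\<close> below involve no choice.
\<close>

definition harmonic_decomp ::
  "(complex \<Rightarrow> complex) \<Rightarrow> (complex \<Rightarrow> complex) \<Rightarrow> (complex \<Rightarrow> complex) \<Rightarrow> bool" where
  "harmonic_decomp f h g \<longleftrightarrow>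
     h holomorphic_on \<bbbD> \<and> g holomorphic_on \<bbbD> \<and> g 0 = 0 \<and>
     (\<forall>z\<in>\<bbbD>. f z = h z + cnj (g z))"

definition H0_decomp ::
  "(complex \<Rightarrow> complex) \<Rightarrow> (complex \<Rightarrow> complex) \<Rightarrow> (complex \<Rightarrow> complex) \<Rightarrow> bool" where
  "H0_decomp f h g \<longleftrightarrow>
     harmonic_decomp f h g \<and>
     (\<exists>a. a 0 = 0 \<and> a 1 = 1 \<and> (\<forall>z\<in>\<bbbD>. (\<lambda>n. a n * z ^ n) sums h z)) \<and>
     (\<exists>b. b 0 = 0 \<and> b 1 = 0 \<and> (\<forall>z\<in>\<bbbD>. (\<lambda>n. b n * z ^ n) sums g z))"

definition Omega_H0 :: "real \<Rightarrow> (complex \<Rightarrow> complex) set" where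
  "Omega_H0 lam =
     {f. \<exists>h g. H0_decomp f h g \<and>
           (\<forall>z\<in>\<bbbD>. norm (h z - z * deriv h z) < lam - norm (g z - z * deriv g z))}"

definition univalent_in :: "(complex \<Rightarrow> complex) \<Rightarrow> complex set \<Rightarrow> bool" where
  "univalent_in f S \<longleftrightarrow> inj_on f S"

text \<open>The library's \<^const>\<open>starlike\<close> leaves the centre unspecified; here it has to be the origin.\<close>

definition starlike_in :: "(complex \<Rightarrow> complex) \<Rightarrow> complex set \<Rightarrow> bool" where
  "starlike_in f S \<longleftrightarrow>
     open (f ` S) \<and> connected (f ` S) \<and> f ` S \<noteq> {} \<and> (\<forall>w\<in>f ` S. closed_segment 0 w \<subseteq> f ` S)"

definition stable_univalent_in :: "(complex \<Rightarrow> complex) \<Rightarrow> complex set \<Rightarrow> bool" where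
  "stable_univalent_in f S \<longleftrightarrow>
     (\<exists>h g. harmonic_decomp f h g \<and>
        (\<forall>\<zeta>. norm \<zeta> = 1 \<longrightarrow> univalent_in (\<lambda>z. h z + \<zeta> * cnj (g z)) S))"

definition stable_starlike_in :: "(complex \<Rightarrow> complex) \<Rightarrow> complex set \<Rightarrow> bool" where
  "stable_starlike_in f S \<longleftrightarrow>
     (\<exists>h g. harmonic_decomp f h g \<and>
        (\<forall>\<zeta>. norm \<zeta> = 1 \<longrightarrow> starlike_in (\<lambda>z. h z + \<zeta> * cnj (g z)) S))"

end

theory Submission
  imports Defs
begin

text \<open>
  Write \<open>h z = z p z\<close> and \<open>g z = z q z\<close>, so that \<open>z h' - h = z\<^sup>2 p'\<close> and \<open>z g' - g = z\<^sup>2 q'\<close>. The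
  maximum principle, applied to \<open>p' + \<epsilon> q'\<close> for each unimodular \<open>\<epsilon>\<close>, turns the hypothesis into
  \<open>|p'| + |q'| \<le> \<lambda>\<close>, and integration gives \<open>|p - 1| + |q| \<le> \<lambda>|z|\<close>. Hence
  \<open>|h' - 1| + |g'| \<le> 2\<lambda>|z| < 1\<close>, which makes \<open>f = h + cnj g\<close> a perturbation of the identity by
  a contraction, hence injective. Moreover
  \<open>|h - z h'| + |g - z g'| \<le> \<lambda>|z|\<^sup>2 < |z| - \<lambda>|z|\<^sup>2 \<le> |h| - |g|\<close>, which forces
  \<open>Re ((z h' - cnj (z g')) cnj f) > 0\<close>, the infinitesimal form of starlikeness. Replacing \<open>g\<close> by
  \<open>cnj \<zeta> g\<close> preserves the hypotheses and yields \<open>h + \<zeta> cnj g\<close>.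
\<close>

section \<open>Rotations, the maximum principle and power series at the origin\<close>

text \<open>Some unimodular \<open>e\<close> turns \<open>e * b\<close> into the direction of
  \<open>a\<close>, so that the triangle inequality becomes an equality. Bounds on the holomorphic
  functions \<open>p + e * q\<close> thereby control sums of norms.\<close>

lemma norm_add_norm_le_of_rotations:
  fixes a b :: complex
  assumes "\<And>e. norm e = 1 \<Longrightarrow> norm (a + e * b) \<le> c"
  shows "norm a + norm b \<le> c"
proof (cases "a = 0 \<or> b = 0")
  case True
  then show ?thesis using assms[of 1] by auto
next
  case False
  define e where "e = sgn a / sgn b"
  have e: "norm e = 1"
    using False by (simp add: e_def norm_divide norm_sgn)
  have "a + e * b = sgn a * of_real (norm a + norm b)"
    using False by (simp add: e_def sgn_eq field_simps)
  then have "norm (a + e * b) = norm a + norm b"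
    using False by (simp only: norm_mult norm_sgn norm_of_real) simp
  then show ?thesis using assms[OF e] by simp
qed

text \<open>On the circle of radius \<open>s\<close> the factor of modulus \<open>s\<^sup>2\<close>
  can be divided out. The maximum principle carries the resulting bound \<open>c / s\<^sup>2\<close>
  inside, and \<open>s\<close> then tends to 1.\<close>

lemma Schwarz_order_two:
  assumes hol: "k holomorphic_on ball 0 1"
    and bound: "\<And>z. z \<in> ball 0 1 \<Longrightarrow> norm (z\<^sup>2 * k z) \<le> c"
    and z: "norm z < 1"
  shows "norm (k z) \<le> c"
proof -
  have bound_s: "norm (k z) \<le> c / s\<^sup>2" if s: "norm z < s" "s < 1" for s
  proof (rule maximum_modulus_frontier[where S = "cball 0 s" and f = k])
    have s0: "s > 0" using s by (meson norm_ge_zero le_less_trans)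
    show "k holomorphic_on interior (cball 0 s)"
      using hol by (rule holomorphic_on_subset) (use s in auto)
    show "continuous_on (closure (cball 0 s)) k"
      using holomorphic_on_imp_continuous_on[OF hol] by (rule continuous_on_subset) (use s in auto)
    show "norm (k x) \<le> c / s\<^sup>2" if "x \<in> frontier (cball 0 s)" for x
    proof -
      have x: "norm x = s" using that s0 by (simp add: frontier_cball)
      show ?thesis
        using bound[of x] x s s0 by (simp add: norm_mult norm_power field_simps)
    qed
  qed (use s in auto)
  have "((\<lambda>s. c / s\<^sup>2) \<longlongrightarrow> c / 1\<^sup>2) (at_left 1)"
    by (intro tendsto_intros) auto
  moreover have "eventually (\<lambda>s. norm (k z) \<le> c / s\<^sup>2) (at_left 1)"
    using eventually_at_left_real[OF z] by eventually_elim (use bound_s in auto)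
  ultimately show ?thesis
    by (metis tendsto_lowerbound trivial_limit_at_left_real power_one div_by_1)
qed

lemma powser_sums_imp_value_deriv_0:
  fixes h :: "complex \<Rightarrow> complex"
  assumes sums: "\<And>z. z \<in> ball 0 1 \<Longrightarrow> (\<lambda>n. a n * z ^ n) sums h z"
  shows "h 0 = a 0" "deriv h 0 = a 1"
proof -
  show "h 0 = a 0"
    using sums[of 0] by (simp add: sums_unique2 powser_sums_zero)
  have "summable (\<lambda>n. a n * (1/2) ^ n)"
    using sums[of "1/2"] by (simp add: sums_iff)
  then have "((\<lambda>x. \<Sum>n. a n * x ^ n) has_field_derivative (\<Sum>n. diffs a n * 0 ^ n)) (at 0)"
    by (rule termdiffs_strong) simp
  then have "((\<lambda>x. \<Sum>n. a n * x ^ n) has_field_derivative a 1) (at 0)"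
    by (simp add: diffs_def)
  then have "(h has_field_derivative a 1) (at 0)"
    by (rule has_field_derivative_transform_within_open[of _ _ _ "ball 0 1"])
       (auto simp: sums_unique[OF sums])
  then show "deriv h 0 = a 1" by (rule DERIV_imp_deriv)
qed

section \<open>Real derivative and injectivity of harmonic maps\<close>

lemma harmonic_has_derivative:
  assumes "(h has_field_derivative a) (at z)" "(g has_field_derivative b) (at z)"
  shows "((\<lambda>z. h z + cnj (g z)) has_derivative (\<lambda>v. a * v + cnj (b * v))) (at z)"
  using assms unfolding has_field_derivative_def
  by (intro has_derivative_add has_derivative_cnj)

text \<open>Subtracting the identity leaves a map \<open>k\<close> with Lipschitz constant below 1
  on each smaller disk. Equal values of the harmonic map at \<open>x\<close> and \<open>y\<close>
  would force \<open>k\<close> to preserve their distance.\<close>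

lemma harmonic_inj_on_ball:
  fixes h g :: "complex \<Rightarrow> complex"
  assumes "h holomorphic_on ball 0 R" "g holomorphic_on ball 0 R"
    and c: "c * R \<le> 1" "c \<ge> 0"
    and bound: "\<And>z. norm z < R \<Longrightarrow> norm (deriv h z - 1) + norm (deriv g z) \<le> c * norm z"
  shows "inj_on (\<lambda>z. h z + cnj (g z)) (ball 0 R)"
proof (rule inj_onI)
  fix x y
  assume xy: "x \<in> ball 0 R" "y \<in> ball 0 R" and eq: "h x + cnj (g x) = h y + cnj (g y)"
  \<comment> \<open>On the closed disk of radius \<open>m < R\<close> the Lipschitz constant is
    \<open>c * m < 1\<close>, whereas on the whole disk only the bound \<open>c * R \<le> 1\<close>
    is known.\<close>
  define m where "m = max (norm x) (norm y)"
  have m: "m < R" "m \<ge> 0" using xy by (auto simp: m_def le_max_iff_disj)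
  define k where "k = (\<lambda>z. h z + cnj (g z) - z)"
  have "norm (k x - k y) \<le> c * m * norm (x - y)"
  proof (rule differentiable_bound[of "cball 0 m" k
        "\<lambda>z v. deriv h z * v + cnj (deriv g z * v) - v"])
    fix z assume z: "z \<in> cball (0::complex) m"
    then have zR: "z \<in> ball 0 R" using m by auto
    have "(h has_field_derivative deriv h z) (at z)" "(g has_field_derivative deriv g z) (at z)"
      using assms zR by (auto intro: holomorphic_derivI)
    from harmonic_has_derivative[OF this]
    show "(k has_derivative (\<lambda>v. deriv h z * v + cnj (deriv g z * v) - v)) (at z within cball 0 m)"
      unfolding k_def by (intro has_derivative_diff has_derivative_ident) (rule has_derivative_at_withinI)
    show "onorm (\<lambda>v. deriv h z * v + cnj (deriv g z * v) - v) \<le> c * m"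
    proof (rule onorm_le)
      fix v
      have "norm (deriv h z * v + cnj (deriv g z * v) - v)
          = norm ((deriv h z - 1) * v + cnj (deriv g z * v))"
        by (simp add: algebra_simps)
      also have "\<dots> \<le> norm ((deriv h z - 1) * v) + norm (cnj (deriv g z * v))"
        by (rule norm_triangle_ineq)
      also have "\<dots> = (norm (deriv h z - 1) + norm (deriv g z)) * norm v"
        by (simp add: norm_mult distrib_right)
      also have "\<dots> \<le> (c * norm z) * norm v"
        using bound[of z] zR by (intro mult_right_mono) auto
      also have "\<dots> \<le> c * m * norm v"
        using z c by (intro mult_right_mono mult_left_mono) auto
      finally show "norm (deriv h z * v + cnj (deriv g z * v) - v) \<le> c * m * norm v" .
    qed
  qed (auto simp: m_def)
  moreover have "norm (k x - k y) = norm (x - y)"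
    using eq by (simp add: k_def norm_minus_commute)
  moreover have "c * m < 1"
  proof (cases "c = 0")
    case False
    then have "c * m < c * R" using m c by simp
    then show ?thesis using c by linarith
  qed simp
  ultimately have "norm (x - y) \<le> c * m * norm (x - y)" "c * m < 1" by simp_all
  then have "norm (x - y) = 0"
    by (metis mult_le_cancel_right1 norm_ge_zero not_le order_le_less)
  then show "x = y" by simp
qed

section \<open>Starlikeness by following preimages along a radius\<close>

text \<open>Continuous induction downwards from 1: if \<open>s\<close> were missing, the least
  element of \<open>T\<close> above \<open>s\<close> would exist by closedness, and
  \<open>step\<close> would produce a smaller one.\<close>

lemma real_interval_closed_left_open_induct:
  fixes T :: "real set"
  assumes "closed T" "1 \<in> T" "0 \<in> T"
    and step: "\<And>t. t \<in> T \<Longrightarrow> 0 < t \<Longrightarrow> t \<le> 1 \<Longrightarrow> \<exists>d>0. \<forall>u>0. u < d \<longrightarrow> t - u \<in> T"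
  shows "{0..1} \<subseteq> T"
proof
  fix s :: real
  assume s: "s \<in> {0..1}"
  show "s \<in> T"
  proof (rule ccontr)
    assume sT: "s \<notin> T"
    define t where "t = Inf (T \<inter> {s..1})"
    have "t \<in> T \<inter> {s..1}"
      unfolding t_def using assms s by (intro closed_contains_Inf) auto
    then have t: "t \<in> T" "s < t" "t \<le> 1" using sT by (auto simp: order_le_less)
    then obtain d where d: "d > 0" "\<And>u. u > 0 \<Longrightarrow> u < d \<Longrightarrow> t - u \<in> T"
      using step[of t] s by auto
    define u where "u = min (d / 2) ((t - s) / 2)"
    have u: "u > 0" "u < d" "t - u \<ge> s" using d t by (auto simp: u_def min_def field_simps)
    then have "t - u \<in> T \<inter> {s..1}" using d t by auto
    then have "t \<le> t - u" unfolding t_def by (intro cInf_lower) auto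
    then show False using u by simp
  qed
qed

text \<open>The positivity hypothesis says that the preimage of \<open>t w\<close> moves
  towards the origin as \<open>t\<close> decreases, so the preimage never leaves the disk.\<close>

lemma harmonic_starlike_in_ball:
  fixes h g :: "complex \<Rightarrow> complex"
  defines "f \<equiv> \<lambda>z. h z + cnj (g z)"
  assumes R: "R > 0"
    and hol: "h holomorphic_on ball 0 R" "g holomorphic_on ball 0 R"
    and zero: "h 0 = 0" "g 0 = 0"
    and inj: "inj_on f (ball 0 R)"
    and jac: "\<And>z. norm z < R \<Longrightarrow> norm (deriv g z) < norm (deriv h z)"
    and pos: "\<And>z. norm z < R \<Longrightarrow> z \<noteq> 0 \<Longrightarrow>
      Re ((z * deriv h z - cnj (z * deriv g z)) * cnj (f z)) > 0"
  shows "starlike_in f (ball 0 R)"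
proof -
  have cont: "continuous_on (ball 0 R) f"
    unfolding f_def using hol by (intro continuous_intros holomorphic_on_imp_continuous_on)
  have open_im: "open (f ` ball 0 R)"
    using cont inj by (intro invariance_of_domain) auto
  define p where "p = inv_into (ball 0 R) f"
  have p: "p (f z) = z" if "norm z < R" for z
    using inj that by (simp add: p_def)
  have fp: "f (p w) = w" if "w \<in> f ` ball 0 R" for w
    using that by (simp add: p_def f_inv_into_f)

  have "closed_segment 0 (f z0) \<subseteq> f ` ball 0 R" if z0: "norm z0 < R" for z0
  proof (cases "f z0 = 0")
    case True
    then show ?thesis using z0 by (auto intro!: image_eqI[of _ _ z0])
  next
    case False
    define w where "w = f z0"
    have w: "w \<noteq> 0" using False by (simp add: w_def)
    \<comment> \<open>Preimages are sought in the closed disk through \<open>z0\<close>: its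
      compactness makes \<open>T\<close> closed, and it stays inside the open disk of radius
      \<open>R\<close>.\<close>
    define T where "T = {t::real. of_real t * w \<in> f ` cball 0 (norm z0)}"
    have sub: "cball 0 (norm z0) \<subseteq> ball 0 R" using z0 by auto
    have "{0..1} \<subseteq> T"
    proof (rule real_interval_closed_left_open_induct)
      have "closed (f ` cball 0 (norm z0))"
        by (intro compact_imp_closed compact_continuous_image continuous_on_subset[OF cont sub]) auto
      moreover have "T = (\<lambda>t::real. of_real t * w) -` (f ` cball 0 (norm z0))"
        by (auto simp: T_def)
      ultimately show "closed T"
        by (auto intro!: continuous_closed_vimage continuous_intros)
      show "1 \<in> T" by (auto simp: T_def w_def)
      show "0 \<in> T" using zero by (auto simp: T_def f_def intro!: image_eqI[of _ _ 0])
    next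
      fix t :: real assume tT: "t \<in> T" and t: "0 < t"
      then obtain z where z: "norm z \<le> norm z0" "of_real t * w = f z"
        by (auto simp: T_def)
      have zR: "norm z < R" using z z0 by simp
      have "z \<noteq> 0" using z t w zero by (auto simp: f_def)
      define a where "a = deriv h z"
      define b where "b = deriv g z"
      \<comment> \<open>\<open>J\<close> is the Jacobian determinant of \<open>f\<close> at
        \<open>z\<close>, and \<open>G\<close> below is the inverse of the real-linear derivative of
        \<open>f\<close> there.\<close>
      define J where "J = (norm a)\<^sup>2 - (norm b)\<^sup>2"
      have J: "J > 0"
        using jac[OF zR] by (simp add: J_def a_def b_def power_strict_mono)
      define G where "G = (\<lambda>v. (cnj a * v - cnj b * cnj v) / of_real J)"
      have "(h has_field_derivative a) (at z)" "(g has_field_derivative b) (at z)"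
        using hol zR unfolding a_def b_def by (auto intro: holomorphic_derivI)
      note derf = harmonic_has_derivative[OF this, folded f_def]
      have "a * G v + cnj (b * G v) = v" for v
      proof -
        have "of_real J * (a * G v + cnj (b * G v))
            = a * (cnj a * v - cnj b * cnj v) + cnj b * (a * cnj v - b * v)"
          using J by (simp add: G_def field_simps)
        also have "\<dots> = (a * cnj a - b * cnj b) * v" by (simp add: algebra_simps)
        also have "\<dots> = of_real J * v"
          by (simp add: J_def complex_norm_square del: of_real_power)
        finally show ?thesis using J by simp
      qed
      then have id: "(\<lambda>v. a * v + cnj (b * v)) \<circ> G = id" by (auto simp: fun_eq_iff)
      have "(p has_derivative G) (at (f z))"
        by (rule has_derivative_inverse_strong[OF _ _ cont _ derf id]) (use zR p in auto)
      then have derp: "(p has_derivative G) (at (of_real t * w))" using z by simp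
      have G_scale: "G (of_real x * w) = of_real x * G w" for x
        by (simp add: G_def algebra_simps diff_divide_distrib)
      have inner_G: "z \<bullet> G (of_real x * w) = x * (z \<bullet> G w)" for x
        unfolding G_scale by (simp add: scaleR_conv_of_real[symmetric])
      have "((\<lambda>s::real. of_real s * w) has_derivative (\<lambda>x. of_real x * w)) (at t)"
        by (auto intro!: derivative_eq_intros)
      then have "((\<lambda>s::real. p (of_real s * w)) has_derivative (\<lambda>x. G (of_real x * w))) (at t)"
        using derp by (rule has_derivative_compose)
      \<comment> \<open>The squared modulus of the preimage of \<open>s w\<close> is differentiated
        at \<open>s = t\<close>, where the preimage is \<open>z\<close>.\<close>
      then have "((\<lambda>s. p (of_real s * w) \<bullet> p (of_real s * w)) has_derivative
          (\<lambda>x. z \<bullet> G (of_real x * w) + G (of_real x * w) \<bullet> z)) (at t)"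
        using has_derivative_inner[of "\<lambda>s::real. p (of_real s * w)" _ t UNIV] p[OF zR] z(2)
        by fastforce
      moreover have "(\<lambda>x. z \<bullet> G (of_real x * w) + G (of_real x * w) \<bullet> z) = (*) (2 * (z \<bullet> G w))"
        by (auto simp: inner_G inner_commute[of "G _"])
      ultimately have der: "((\<lambda>s. p (of_real s * w) \<bullet> p (of_real s * w))
          has_real_derivative 2 * (z \<bullet> G w)) (at t)"
        by (simp add: has_field_derivative_def)
      \<comment> \<open>The positive factor \<open>t\<close> replaces \<open>w\<close> by
        \<open>t w = f z\<close>, which brings the derivative into the form governed by
        \<open>pos\<close>.\<close>
      have "t * (z \<bullet> G w) = z \<bullet> G (f z)"
        using inner_G[of t] z(2) by simp
      also have "\<dots> = Re (cnj z * G (f z))" by (simp add: inner_complex_def)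
      also have "\<dots> = Re (cnj (z * a) * f z - cnj (z * b) * cnj (f z)) / J"
        by (simp add: G_def algebra_simps diff_divide_distrib add_divide_distrib)
      also have "Re (cnj (z * a) * f z - cnj (z * b) * cnj (f z))
          = Re ((z * a - cnj (z * b)) * cnj (f z))"
        by (simp add: algebra_simps)
      finally have "t * (z \<bullet> G w) > 0"
        using pos[OF zR \<open>z \<noteq> 0\<close>] J by (simp add: a_def b_def)
      then have "2 * (z \<bullet> G w) > 0" using t by (simp add: zero_less_mult_iff)
      from DERIV_pos_inc_left[OF der this] obtain d1 where d1: "d1 > 0"
        "\<And>u. u > 0 \<Longrightarrow> u < d1 \<Longrightarrow> norm (p (of_real (t - u) * w)) < norm z"
        using p[OF zR] z(2) by (auto simp: norm_lt)
      \<comment> \<open>The inverse \<open>p\<close> yields genuine preimages only on the image of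
        \<open>f\<close>; openness keeps \<open>s w\<close> in that image for \<open>s\<close> near
        \<open>t\<close>.\<close>
      have "open ((\<lambda>s::real. of_real s * w) -` (f ` ball 0 R))"
        by (rule continuous_open_vimage[OF open_im]) (auto intro!: continuous_intros)
      moreover have "t \<in> (\<lambda>s::real. of_real s * w) -` (f ` ball 0 R)"
        using z zR by auto
      ultimately obtain d2 where d2: "d2 > 0"
        "\<And>s. dist s t < d2 \<Longrightarrow> of_real s * w \<in> f ` ball 0 R"
        unfolding open_dist by (metis vimageD)
      show "\<exists>d>0. \<forall>u>0. u < d \<longrightarrow> t - u \<in> T"
      proof (intro exI[of _ "min d1 d2"] conjI allI impI)
        fix u :: real assume u: "0 < u" "u < min d1 d2"
        have "f (p (of_real (t - u) * w)) = of_real (t - u) * w"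
          using u by (intro fp d2) (auto simp: dist_real_def)
        moreover have "norm (p (of_real (t - u) * w)) \<le> norm z0"
          using d1(2)[of u] u z(1) by simp
        ultimately show "t - u \<in> T"
          unfolding T_def by (metis (mono_tags, lifting) image_eqI mem_Collect_eq mem_cball_0)
      qed (use d1 d2 in auto)
    qed
    then have "of_real u * w \<in> f ` ball 0 R" if "u \<in> {0..1}" for u
    proof -
      have "u \<in> T" using that \<open>{0..1} \<subseteq> T\<close> by (rule subsetD[rotated])
      then have "of_real u * w \<in> f ` cball 0 (norm z0)" by (simp add: T_def)
      then show ?thesis by (rule subsetD[OF image_mono[OF sub]])
    qed
    then show ?thesis
      by (auto simp: w_def closed_segment_def scaleR_conv_of_real)
  qed
  moreover have "connected (f ` ball 0 R)"
    using cont by (rule connected_continuous_image) auto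
  ultimately show ?thesis
    unfolding starlike_in_def using open_im R by auto
qed

section \<open>Estimates for the class and the conclusion\<close>

text \<open>Expanding the product leaves the real main term \<open>|H|^2 - |G|^2\<close>, a purely
  imaginary term, and errors of modulus at most \<open>(|A| + |B|) (|H| + |G|)\<close>. It serves
  with \<open>A = h - z h'\<close> and \<open>B = g - z g'\<close>, where
  \<open>H - A = z h'\<close> and \<open>G - B = z g'\<close>.\<close>

lemma harmonic_radial_positive:
  fixes H G A B :: complex
  assumes "norm A + norm B < norm H - norm G"
  shows "Re ((H - A - cnj (G - B)) * cnj (H + cnj G)) > 0"
proof -
  have "(H - A - cnj (G - B)) * cnj (H + cnj G)
      = of_real ((norm H)\<^sup>2 - (norm G)\<^sup>2) + (H * G - cnj (H * G))
        + (cnj B * cnj H - A * G) + (cnj B * G - A * cnj H)"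
    by (simp add: complex_norm_square algebra_simps del: of_real_power)
  then have eq: "Re ((H - A - cnj (G - B)) * cnj (H + cnj G))
      = (norm H)\<^sup>2 - (norm G)\<^sup>2 + Re (cnj B * cnj H - A * G) + Re (cnj B * G - A * cnj H)"
    by simp
  have "norm (cnj B * cnj H - A * G) \<le> norm B * norm H + norm A * norm G"
    by (rule order_trans[OF norm_triangle_ineq4]) (simp add: norm_mult)
  moreover have "norm (cnj B * G - A * cnj H) \<le> norm B * norm G + norm A * norm H"
    by (rule order_trans[OF norm_triangle_ineq4]) (simp add: norm_mult)
  moreover have "(norm A + norm B) * (norm H + norm G) < (norm H - norm G) * (norm H + norm G)"
  proof (intro mult_strict_right_mono assms)
    show "0 < norm H + norm G"
      using assms norm_ge_zero[of A] norm_ge_zero[of B] norm_ge_zero[of G] by linarith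
  qed
  ultimately show ?thesis
    using abs_Re_le_cmod[of "cnj B * cnj H - A * G"] abs_Re_le_cmod[of "cnj B * G - A * cnj H"]
    unfolding eq by (simp add: algebra_simps power2_eq_square abs_le_iff)
qed

text \<open>The case of \<open>\<zeta> = 1\<close>, from which the other rotations follow by
  changing \<open>g\<close>. The minimum with 1 in \<open>R\<close> keeps the disk inside the unit
  disk when \<open>lam < 1/2\<close>.\<close>

lemma univalent_starlike_of_bound:
  fixes lam :: real and h g :: "complex \<Rightarrow> complex"
  defines "R \<equiv> min 1 (1 / (2 * lam))"
  assumes lam: "lam > 0"
    and hol: "h holomorphic_on \<bbbD>" "g holomorphic_on \<bbbD>"
    and norml: "h 0 = 0" "deriv h 0 = 1" "g 0 = 0" "deriv g 0 = 0"
    and bound: "\<And>z. z \<in> \<bbbD> \<Longrightarrow> norm (h z - z * deriv h z) + norm (g z - z * deriv g z) \<le> lam"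
  shows "inj_on (\<lambda>z. h z + cnj (g z)) (ball 0 R)"
    and "starlike_in (\<lambda>z. h z + cnj (g z)) (ball 0 R)"
proof -
  obtain p where p: "p holomorphic_on \<bbbD>" "\<And>z. z \<in> \<bbbD> \<Longrightarrow> h z = z * p z" "p 0 = 1"
    using Schwarz3[of h 1] hol norml by (metis mem_ball_0)
  obtain q where q: "q holomorphic_on \<bbbD>" "\<And>z. z \<in> \<bbbD> \<Longrightarrow> g z = z * q z" "q 0 = 0"
    using Schwarz3[of g 1] hol norml by (metis mem_ball_0)
  have deriv_mult_id: "deriv k z = r z + z * deriv r z"
    if "r holomorphic_on \<bbbD>" "\<And>z. z \<in> \<bbbD> \<Longrightarrow> k z = z * r z" "z \<in> \<bbbD>" for k r z
  proof (rule DERIV_imp_deriv)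
    have "(r has_field_derivative deriv r z) (at z)"
      using that by (auto intro: holomorphic_derivI)
    then have "((\<lambda>z. z * r z) has_field_derivative r z + z * deriv r z) (at z)"
      by (auto intro!: derivative_eq_intros)
    then show "(k has_field_derivative r z + z * deriv r z) (at z)"
      by (rule has_field_derivative_transform_within_open[of _ _ _ "\<bbbD>"]) (use that in auto)
  qed
  have dh: "deriv h z = p z + z * deriv p z" and dg: "deriv g z = q z + z * deriv q z"
    if "z \<in> \<bbbD>" for z
    using deriv_mult_id[of p h] deriv_mult_id[of q g] p q that by auto
  have diff_h: "h z - z * deriv h z = - (z\<^sup>2 * deriv p z)"
    and diff_g: "g z - z * deriv g z = - (z\<^sup>2 * deriv q z)" if "z \<in> \<bbbD>" for z
    using that by (simp_all add: p(2) q(2) dh dg algebra_simps power2_eq_square)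

  have rot: "norm (deriv p z + e * deriv q z) \<le> lam" if e: "norm e = 1" and z: "z \<in> \<bbbD>" for e z
  proof (rule Schwarz_order_two[of "\<lambda>z. deriv p z + e * deriv q z"])
    show "(\<lambda>z. deriv p z + e * deriv q z) holomorphic_on \<bbbD>"
      using p q by (intro holomorphic_intros) auto
    show "norm (z\<^sup>2 * (deriv p z + e * deriv q z)) \<le> lam" if "z \<in> \<bbbD>" for z
    proof -
      have "norm (z\<^sup>2 * (deriv p z + e * deriv q z))
          \<le> norm (z\<^sup>2 * deriv p z) + norm (e * (z\<^sup>2 * deriv q z))"
        by (rule order_trans[OF _ norm_triangle_ineq]) (simp add: algebra_simps)
      then show ?thesis using bound[OF that] diff_h[OF that] diff_g[OF that] e
        by (simp add: norm_mult)
    qed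
  qed (use z in auto)
  have pq': "norm (deriv p z) + norm (deriv q z) \<le> lam" if "z \<in> \<bbbD>" for z
    using rot that by (intro norm_add_norm_le_of_rotations)
  \<comment> \<open>The mean value inequality applies to \<open>p + e * q\<close>, whose value at 0
    is 1, before the rotations separate the two norms.\<close>
  have pq: "norm (p z - 1) + norm (q z) \<le> lam * norm z" if "z \<in> \<bbbD>" for z
  proof (rule norm_add_norm_le_of_rotations)
    fix e :: complex assume e: "norm e = 1"
    have "norm ((p z + e * q z) - (p 0 + e * q 0)) \<le> lam * norm (z - 0)"
    proof (rule field_differentiable_bound[of "\<bbbD>"])
      fix x assume x: "x \<in> \<bbbD>"
      have "(p has_field_derivative deriv p x) (at x within \<bbbD>)"
        "(q has_field_derivative deriv q x) (at x within \<bbbD>)"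
        using p q x by (auto intro: holomorphic_derivI)
      then show "((\<lambda>z. p z + e * q z) has_field_derivative deriv p x + e * deriv q x) (at x within \<bbbD>)"
        by (auto intro!: derivative_eq_intros)
      show "norm (deriv p x + e * deriv q x) \<le> lam" using rot e x by simp
    qed (use that in auto)
    then show "norm ((p z - 1) + e * q z) \<le> lam * norm z"
      using p q by (simp add: algebra_simps)
  qed
  have deriv_bound: "norm (deriv h z - 1) + norm (deriv g z) \<le> 2 * lam * norm z"
    if z: "z \<in> \<bbbD>" for z
  proof -
    have "norm (deriv h z - 1) \<le> norm (p z - 1) + norm z * norm (deriv p z)"
      using norm_triangle_ineq[of "p z - 1" "z * deriv p z"] dh[OF z]
      by (simp add: norm_mult algebra_simps)
    moreover have "norm (deriv g z) \<le> norm (q z) + norm z * norm (deriv q z)"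
      using norm_triangle_ineq[of "q z" "z * deriv q z"] dg[OF z]
      by (simp add: norm_mult)
    moreover have "norm z * (norm (deriv p z) + norm (deriv q z)) \<le> norm z * lam"
      using pq'[OF z] by (intro mult_left_mono) auto
    ultimately show ?thesis using pq[OF z] by (simp add: algebra_simps)
  qed

  have R: "R > 0" "ball 0 R \<subseteq> \<bbbD>" "2 * lam * R \<le> 1"
  proof -
    show "R > 0" using lam by (simp add: R_def)
    show "ball 0 R \<subseteq> \<bbbD>" by (rule subset_ball) (simp add: R_def)
    have "R \<le> 1 / (2 * lam)" by (simp add: R_def)
    then show "2 * lam * R \<le> 1" using lam by (simp add: field_simps)
  qed
  have holR: "h holomorphic_on ball 0 R" "g holomorphic_on ball 0 R"
    using hol R(2) by (auto intro: holomorphic_on_subset)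
  have inD: "z \<in> \<bbbD>" "2 * lam * norm z < 1" if "norm z < R" for z
  proof -
    show "z \<in> \<bbbD>" using that R by auto
    have "2 * lam * norm z < 2 * lam * R" using that lam by simp
    then show "2 * lam * norm z < 1" using R by linarith
  qed
  show inj: "inj_on (\<lambda>z. h z + cnj (g z)) (ball 0 R)"
    by (rule harmonic_inj_on_ball[OF holR R(3)]) (use lam deriv_bound inD in auto)
  show "starlike_in (\<lambda>z. h z + cnj (g z)) (ball 0 R)"
  proof (rule harmonic_starlike_in_ball[OF R(1) holR norml(1,3) inj])
    fix z :: complex assume z: "norm z < R"
    note D = inD[OF z]
    \<comment> \<open>Since \<open>|h' - 1| + |g'| < 1\<close>, this gives
      \<open>|g'| < 1 - |h' - 1| \<le> |h'|\<close>, so \<open>f\<close> preserves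
      orientation.\<close>
    have "1 \<le> norm (deriv h z - 1) + norm (deriv h z)"
      using norm_triangle_ineq4[of "deriv h z" "deriv h z - 1"] by simp
    then show "norm (deriv g z) < norm (deriv h z)"
      using deriv_bound[OF D(1)] D(2) by linarith
    assume "z \<noteq> 0"
    define A where "A = h z - z * deriv h z"
    define B where "B = g z - z * deriv g z"
    have "norm A + norm B = (norm z)\<^sup>2 * (norm (deriv p z) + norm (deriv q z))"
      unfolding A_def B_def diff_h[OF D(1)] diff_g[OF D(1)]
      by (simp add: norm_mult norm_power algebra_simps)
    also have "\<dots> \<le> (norm z)\<^sup>2 * lam"
      using pq'[OF D(1)] by (intro mult_left_mono) auto
    \<comment> \<open>This is where the radius enters: the inequality amounts to
      \<open>2 * lam * |z| < 1\<close>, multiplied by \<open>|z| > 0\<close>.\<close>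
    also have "\<dots> < norm z * (1 - lam * norm z)"
    proof -
      have "norm z * (2 * lam * norm z) < norm z * 1"
        using D(2) \<open>z \<noteq> 0\<close> by (intro mult_strict_left_mono) auto
      then show ?thesis by (simp add: algebra_simps power2_eq_square)
    qed
    also have "\<dots> \<le> norm z * (norm (p z) - norm (q z))"
    proof (rule mult_left_mono)
      show "1 - lam * norm z \<le> norm (p z) - norm (q z)"
        using norm_triangle_ineq4[of "p z" "p z - 1"] pq[OF D(1)] by simp
    qed auto
    also have "\<dots> = norm (h z) - norm (g z)"
      by (simp add: p(2)[OF D(1)] q(2)[OF D(1)] norm_mult algebra_simps)
    finally have "norm A + norm B < norm (h z) - norm (g z)" .
    from harmonic_radial_positive[OF this]
    show "Re ((z * deriv h z - cnj (z * deriv g z)) * cnj (h z + cnj (g z))) > 0"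
      by (simp add: A_def B_def)
  qed
qed

theorem corollary2p1:
  fixes lam :: real and f :: "complex \<Rightarrow> complex"
  assumes "lam > 0" and "f \<in> Omega_H0 lam"
  shows "stable_univalent_in f {z \<in> \<bbbD>. norm z < 1 / (2 * lam)}
    \<and> stable_starlike_in f {z \<in> \<bbbD>. norm z < 1 / (2 * lam)}
    \<and> univalent_in f {z \<in> \<bbbD>. norm z < 1 / (2 * lam)}
    \<and> starlike_in f {z \<in> \<bbbD>. norm z < 1 / (2 * lam)}"
proof -
  have S: "{z \<in> \<bbbD>. norm z < 1 / (2 * lam)} = ball 0 (min 1 (1 / (2 * lam)))"
    by auto
  obtain h g where dec: "H0_decomp f h g"
    and bound: "\<And>z. z \<in> \<bbbD> \<Longrightarrow> norm (h z - z * deriv h z) < lam - norm (g z - z * deriv g z)"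
    using assms(2) unfolding Omega_H0_def by blast
  from dec have harm: "harmonic_decomp f h g" by (simp add: H0_decomp_def)
  then have hol: "h holomorphic_on \<bbbD>" "g holomorphic_on \<bbbD>"
    and f: "\<And>z. z \<in> \<bbbD> \<Longrightarrow> f z = h z + cnj (g z)"
    by (auto simp: harmonic_decomp_def)
  have norml: "h 0 = 0" "deriv h 0 = 1" "g 0 = 0" "deriv g 0 = 0"
    using dec powser_sums_imp_value_deriv_0[of _ h] powser_sums_imp_value_deriv_0[of _ g]
    unfolding H0_decomp_def by metis+
  have rot: "inj_on (\<lambda>z. h z + e * cnj (g z)) (ball 0 (min 1 (1 / (2 * lam))))"
      "starlike_in (\<lambda>z. h z + e * cnj (g z)) (ball 0 (min 1 (1 / (2 * lam))))"
    if e: "norm e = 1" for e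
  proof -
    \<comment> \<open>Conjugation turns the factor \<open>cnj e\<close> into \<open>e\<close>, and
      its unit modulus leaves \<open>|g - z g'|\<close> unchanged.\<close>
    define k where "k = (\<lambda>z. cnj e * g z)"
    have k': "deriv k z = cnj e * deriv g z" if "z \<in> \<bbbD>" for z
      unfolding k_def using hol that by (intro deriv_cmult holomorphic_on_imp_differentiable_at) auto
    have "norm (k z - z * deriv k z) = norm (g z - z * deriv g z)" if "z \<in> \<bbbD>" for z
    proof -
      have "k z - z * deriv k z = cnj e * (g z - z * deriv g z)"
        using k'[OF that] by (simp add: k_def algebra_simps)
      then show ?thesis using e by (simp add: norm_mult)
    qed
    then have *: "norm (h z - z * deriv h z) + norm (k z - z * deriv k z) \<le> lam" if "z \<in> \<bbbD>" for z
      using bound[OF that] that by simp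
    have **: "k holomorphic_on \<bbbD>" "k 0 = 0" "deriv k 0 = 0"
      using hol norml k'[of 0] by (auto simp: k_def intro!: holomorphic_intros)
    have "h z + cnj (k z) = h z + e * cnj (g z)" for z by (simp add: k_def)
    then show "inj_on (\<lambda>z. h z + e * cnj (g z)) (ball 0 (min 1 (1 / (2 * lam))))"
      "starlike_in (\<lambda>z. h z + e * cnj (g z)) (ball 0 (min 1 (1 / (2 * lam))))"
      using univalent_starlike_of_bound[OF assms(1) hol(1) **(1) norml(1,2) **(2,3) *] by simp_all
  qed
  \<comment> \<open>For \<open>f\<close> itself the rotation is \<open>e = 1\<close>;
    \<open>f\<close> agrees with \<open>h + cnj g\<close> on the disk, and
    \<open>starlike_in\<close> depends only on the image.\<close>
  have im: "f ` ball 0 (min 1 (1 / (2 * lam)))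
      = (\<lambda>z. h z + 1 * cnj (g z)) ` ball 0 (min 1 (1 / (2 * lam)))"
    using f by (intro image_cong) auto
  have "inj_on f (ball 0 (min 1 (1 / (2 * lam))))"
    using rot(1)[of 1] f by (subst inj_on_cong[where g = "\<lambda>z. h z + 1 * cnj (g z)"]) auto
  moreover have "starlike_in f (ball 0 (min 1 (1 / (2 * lam))))"
    using rot(2)[of 1] unfolding starlike_in_def im by simp
  ultimately show ?thesis
    unfolding S stable_univalent_in_def stable_starlike_in_def univalent_in_def
    using harm rot by blast
qed

end
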